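(* Let $R$ be a weakly semicommutative ring with identity. Then $R$ is Dischinger.
   Context: $\mathrm{N}(R)$ denotes the set of nilpotent elements of a ring $R$. A ring $R$ is weakly semicommutative if for all $a,b\in R$, $ab=0$ implies $aRb\subseteq \mathrm{N}(R)$. An element $a\in R$ is right strongly regular if $a=a^2x$ for some $x\in R$, left strongly regular if $a=ya^2$ for some $y\in R$, and strongly regular if both. $R$ is right (respectively left) Dischinger if every right (respectively left) strongly regular element of $R$ is strongly regular; $R$ is Dischinger if it is both left and right Dischinger. *)

theory Defs
  imports "HOL-Algebra.Ring"
begin

(* Ring elements, quantifiers and powers are all relative to carrier R.  The locale ring of
   HOL-Algebra is that of associative rings with identity, not necessarily commutative; the
   zero ring is allowed. *)

definition nilpotents :: "('a, 'b) ring_scheme \<Rightarrow> 'a set" where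
  "nilpotents R = {x \<in> carrier R. \<exists>n::nat. n > 0 \<and> x [^]\<^bsub>R\<^esub> n = \<zero>\<^bsub>R\<^esub>}"

definition weakly_semicommutative :: "('a, 'b) ring_scheme \<Rightarrow> bool" where
  "weakly_semicommutative R \<longleftrightarrow>
     (\<forall>a\<in>carrier R. \<forall>b\<in>carrier R. a \<otimes>\<^bsub>R\<^esub> b = \<zero>\<^bsub>R\<^esub> \<longrightarrow>
        {a \<otimes>\<^bsub>R\<^esub> r \<otimes>\<^bsub>R\<^esub> b | r. r \<in> carrier R} \<subseteq> nilpotents R)"

definition right_strongly_regular :: "('a, 'b) ring_scheme \<Rightarrow> 'a \<Rightarrow> bool" where
  "right_strongly_regular R a \<longleftrightarrow>
     a \<in> carrier R \<and> (\<exists>x\<in>carrier R. a = a [^]\<^bsub>R\<^esub> (2::nat) \<otimes>\<^bsub>R\<^esub> x)"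

definition left_strongly_regular :: "('a, 'b) ring_scheme \<Rightarrow> 'a \<Rightarrow> bool" where
  "left_strongly_regular R a \<longleftrightarrow>
     a \<in> carrier R \<and> (\<exists>y\<in>carrier R. a = y \<otimes>\<^bsub>R\<^esub> a [^]\<^bsub>R\<^esub> (2::nat))"

definition strongly_regular :: "('a, 'b) ring_scheme \<Rightarrow> 'a \<Rightarrow> bool" where
  "strongly_regular R a \<longleftrightarrow> left_strongly_regular R a \<and> right_strongly_regular R a"

definition right_Dischinger :: "('a, 'b) ring_scheme \<Rightarrow> bool" where
  "right_Dischinger R \<longleftrightarrow>
     (\<forall>a\<in>carrier R. right_strongly_regular R a \<longrightarrow> strongly_regular R a)"

definition left_Dischinger :: "('a, 'b) ring_scheme \<Rightarrow> bool" where
  "left_Dischinger R \<longleftrightarrow>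
     (\<forall>a\<in>carrier R. left_strongly_regular R a \<longrightarrow> strongly_regular R a)"

definition Dischinger :: "('a, 'b) ring_scheme \<Rightarrow> bool" where
  "Dischinger R \<longleftrightarrow> left_Dischinger R \<and> right_Dischinger R"

end

theory Submission
  imports Defs "HOL-Algebra.Multiplicative_Group"
begin

text \<open>
  Let \<open>a = a\<^sup>2 x\<close> and put \<open>f = a x\<close>, so that \<open>a (1 - f) = 0\<close>. Weak semicommutativity
  makes \<open>f (1 - f) = a x (1 - f)\<close> nilpotent, so \<open>f\<close> can be improved to an idempotent \<open>e \<in> a R\<close>
  that still satisfies \<open>a e = a\<close> (lemma \<open>idempotent_from_nilpotent\<close>). Choose \<open>w\<close> with \<open>a w = e\<close>
  and \<open>e w = w = w e\<close>. In the corner ring \<open>e R e\<close> the element \<open>w\<close> is a right inverse of \<open>e a\<close>.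
  As in the proof that weakly semicommutative rings are Dedekind-finite, the defect \<open>e - w a\<close> of
  the left inverse is an idempotent killed by \<open>e a\<close> on the left. The hypothesis thus makes
  \<open>(e a) w (e - w a) = e - w a\<close> nilpotent, and a nilpotent idempotent is zero. From \<open>e = w a\<close>
  follow \<open>a = a e = (a w) a = e a = w a\<^sup>2\<close>, which is left strong regularity.

  Weak semicommutativity is invariant under passing to the opposite ring, and this exchanges left
  and right strong regularity, so the other half needs no separate argument.
\<close>

context ring
begin

lemma one_minus_pow_factor:
  assumes f: "f \<in> carrier R"
  shows "\<exists>s\<in>carrier R. s \<otimes> f = f \<otimes> s \<and> (\<one> \<ominus> f) [^] (n::nat) = \<one> \<ominus> f \<otimes> s"
proof (induction n)
  case 0
  show ?case using f by (intro bexI[of _ \<zero>]) (auto simp: minus_eq)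
next
  case (Suc n)
  then obtain s where s: "s \<in> carrier R" "s \<otimes> f = f \<otimes> s"
      "(\<one> \<ominus> f) [^] n = \<one> \<ominus> f \<otimes> s" by blast
  define t where "t = \<one> \<oplus> s \<ominus> s \<otimes> f"
  have t: "t \<in> carrier R" unfolding t_def using f s by simp
  have "s \<otimes> f \<otimes> f = f \<otimes> (s \<otimes> f)"
    using f s by (simp add: m_assoc)
  hence "t \<otimes> f = f \<otimes> t"
    unfolding t_def minus_eq using f s(1,2) by (simp add: l_distr r_distr l_minus r_minus)
  moreover have "(\<one> \<ominus> f) [^] Suc n = \<one> \<ominus> f \<otimes> t"
  proof -
    have "(\<one> \<ominus> f) [^] Suc n = (\<one> \<ominus> f \<otimes> s) \<otimes> (\<one> \<ominus> f)" using s by simp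
    also have "\<dots> = \<one> \<ominus> f \<otimes> t" unfolding t_def using f s(1)
      by (simp add: minus_eq l_distr r_distr l_minus r_minus minus_add minus_minus a_ac m_assoc)
    finally show ?thesis .
  qed
  ultimately show ?case using t by blast
qed

lemma right_fixed_pow:
  assumes "a \<in> carrier R" "h \<in> carrier R" "a \<otimes> h = a"
  shows "a \<otimes> h [^] (n::nat) = a"
  using assms by (induction n) (auto simp flip: m_assoc)

lemma nilpotent_idempotent_zero:
  assumes p: "p \<otimes> p = p" and nil: "p \<in> nilpotents R"
  shows "p = \<zero>"
proof -
  from nil obtain n :: nat where pc: "p \<in> carrier R" and n: "p [^] n = \<zero>"
    unfolding nilpotents_def by blast
  have "p \<otimes> p [^] n = p" using right_fixed_pow[OF pc pc p] .
  thus ?thesis using n pc by simp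
qed

text \<open>
  With \<open>f\<^sup>n (1 - f)\<^sup>n = 0\<close>, the element \<open>h = 1 - (1 - f)\<^sup>n\<close> is a multiple \<open>f s\<close> of \<open>f\<close> by an
  element commuting with \<open>f\<close>. Hence \<open>h\<^sup>n (1 - h) = s\<^sup>n f\<^sup>n (1 - f)\<^sup>n = 0\<close>, so multiplying \<open>h\<^sup>n\<close> by
  \<open>h\<close> changes nothing and \<open>h\<^sup>n\<close> is idempotent. Unlike the usual lifting of idempotents
  modulo a nil ideal, what is tracked here is that \<open>e\<close> stays in \<open>f R\<close> and that \<open>a e = a\<close>
  is inherited from \<open>a f = a\<close>.
\<close>

lemma idempotent_from_nilpotent:
  assumes f: "f \<in> carrier R" and nil: "f \<otimes> (\<one> \<ominus> f) \<in> nilpotents R"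
    and a: "a \<in> carrier R" "a \<otimes> f = a"
  obtains e r where "e \<in> carrier R" "r \<in> carrier R" "e \<otimes> e = e" "e = f \<otimes> r" "a \<otimes> e = a"
proof -
  from nil obtain n :: nat where n: "n > 0" "(f \<otimes> (\<one> \<ominus> f)) [^] n = \<zero>"
    unfolding nilpotents_def by blast
  obtain m where m: "n = Suc m" using n(1) gr0_implies_Suc by blast
  obtain s where s: "s \<in> carrier R" "s \<otimes> f = f \<otimes> s" "(\<one> \<ominus> f) [^] n = \<one> \<ominus> f \<otimes> s"
    using one_minus_pow_factor[OF f] by blast
  define h where "h = f \<otimes> s"
  have h: "h \<in> carrier R" unfolding h_def using f s by simp
  have comm: "f \<otimes> (\<one> \<ominus> f) = (\<one> \<ominus> f) \<otimes> f"
    using f by (simp add: minus_eq l_distr r_distr l_minus r_minus)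
  have "f [^] n \<otimes> (\<one> \<ominus> f) [^] n = \<zero>"
    using pow_mult_distrib[OF comm, of n] n(2) f by simp
  hence fh: "f [^] n \<otimes> (\<one> \<ominus> h) = \<zero>" using s(3) by (simp add: h_def)
  have "h [^] n = s [^] n \<otimes> f [^] n"
    unfolding h_def s(2)[symmetric] by (rule pow_mult_distrib) (use s f in auto)
  hence "h [^] n \<otimes> (\<one> \<ominus> h) = \<zero>"
    using fh s(1) f h by (simp add: m_assoc)
  hence "h [^] n \<ominus> h [^] n \<otimes> h = \<zero>"
    using h by (simp add: minus_eq r_distr r_minus)
  hence "h [^] n \<otimes> h = h [^] n" using h by simp
  hence idem: "h [^] n \<otimes> h [^] n = h [^] n" using right_fixed_pow h by simp
  have "a \<otimes> h [^] n = a"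
  proof (rule right_fixed_pow[OF a(1) h])
    have "a \<otimes> (\<one> \<ominus> f) = \<zero>"
      using a f by (simp add: minus_eq r_distr r_minus r_neg)
    hence "a \<otimes> (\<one> \<ominus> f) [^] n = \<zero>"
      unfolding m nat_pow_Suc2[OF minus_closed[OF one_closed f]]
      using a f by (simp flip: m_assoc)
    hence "a \<otimes> (\<one> \<ominus> h) = \<zero>" using s(3) by (simp add: h_def)
    hence "a \<ominus> a \<otimes> h = \<zero>" using a h by (simp add: minus_eq r_distr r_minus)
    thus "a \<otimes> h = a" using a h by simp
  qed
  moreover have "h [^] n = f \<otimes> (s \<otimes> h [^] m)"
    unfolding m nat_pow_Suc2[OF h] using f s(1) h by (simp add: h_def m_assoc)
  ultimately show thesis using idem that h s(1) by (metis m_closed nat_pow_closed)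
qed

lemma weakly_semicommutativeD:
  assumes "weakly_semicommutative R" "a \<in> carrier R" "b \<in> carrier R" "r \<in> carrier R"
    and "a \<otimes> b = \<zero>"
  shows "a \<otimes> r \<otimes> b \<in> nilpotents R"
  using assms unfolding weakly_semicommutative_def by blast

lemma right_strongly_regular_imp_left:
  assumes wsc: "weakly_semicommutative R" and reg: "right_strongly_regular R a"
  shows "left_strongly_regular R a"
proof -
  from reg obtain x where a: "a \<in> carrier R" and x: "x \<in> carrier R"
    and ax: "a = a \<otimes> a \<otimes> x"
    unfolding right_strongly_regular_def by (auto simp: numeral_2_eq_2)
  have af: "a \<otimes> (a \<otimes> x) = a" using a x ax by (simp add: m_assoc)
  have "a \<otimes> (\<one> \<ominus> a \<otimes> x) = \<zero>"
    using a x af by (simp add: minus_eq r_distr r_minus r_neg)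
  hence "a \<otimes> x \<otimes> (\<one> \<ominus> a \<otimes> x) \<in> nilpotents R"
    using weakly_semicommutativeD[OF wsc] a x by simp
  then obtain e r where e: "e \<in> carrier R" "e \<otimes> e = e" and r: "r \<in> carrier R"
    and er: "e = a \<otimes> x \<otimes> r" and ae: "a \<otimes> e = a"
    using idempotent_from_nilpotent a x af by (metis m_closed)
  \<comment> \<open>Compressing \<open>x r\<close> to the corner \<open>e R e\<close> keeps the equation \<open>a w = e\<close>, because
    \<open>a e = a\<close>, and makes \<open>w a\<close> an idempotent fixed by \<open>e\<close> on both sides.\<close>
  define w where "w = e \<otimes> (x \<otimes> r) \<otimes> e"
  have w: "w \<in> carrier R" using e r x by (simp add: w_def)
  have ew: "e \<otimes> w = w" using e r x by (simp add: w_def flip: m_assoc)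
  have we: "w \<otimes> e = w" using e r x by (simp add: w_def m_assoc)
  have aw: "a \<otimes> w = e"
  proof -
    have "a \<otimes> w = (a \<otimes> e) \<otimes> (x \<otimes> r) \<otimes> e" using a e(1) r x by (simp add: w_def m_assoc)
    also have "\<dots> = (a \<otimes> x \<otimes> r) \<otimes> e" using a e(1) r x ae by (simp add: m_assoc)
    finally show ?thesis using er e by simp
  qed
  define g where "g = w \<otimes> a"
  have g: "g \<in> carrier R" using w a by (simp add: g_def)
  have eg: "e \<otimes> g = g" using ew e w a by (simp add: g_def flip: m_assoc)
  have ge: "g \<otimes> e = g" using ae e w a by (simp add: g_def m_assoc)
  have ag: "a \<otimes> g = e \<otimes> a" using aw w a by (simp add: g_def flip: m_assoc)
  have gg: "g \<otimes> g = g"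
  proof -
    have "g \<otimes> g = w \<otimes> (a \<otimes> g)" using w a g by (simp add: g_def m_assoc)
    also have "\<dots> = (w \<otimes> e) \<otimes> a" using ag w e a by (simp add: m_assoc)
    finally show ?thesis using we by (simp add: g_def)
  qed
  have "e \<ominus> g = \<zero>"
  proof (rule nilpotent_idempotent_zero)
    show "(e \<ominus> g) \<otimes> (e \<ominus> g) = e \<ominus> g"
      using e g eg ge gg
      by (simp add: minus_eq l_distr r_distr l_minus r_minus r_neg)
    have "e \<otimes> a \<otimes> e = e \<otimes> a" using e a ae by (simp add: m_assoc)
    moreover have "e \<otimes> a \<otimes> g = e \<otimes> a" using e a g ag by (simp add: m_assoc) (simp add: e a flip: m_assoc)
    ultimately have "e \<otimes> a \<otimes> (e \<ominus> g) = \<zero>"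
      using e g a by (simp add: minus_eq r_distr r_minus r_neg)
    hence "e \<otimes> a \<otimes> w \<otimes> (e \<ominus> g) \<in> nilpotents R"
      using weakly_semicommutativeD[OF wsc] e a w g by simp
    moreover have "e \<otimes> a \<otimes> w = e" using e a w aw by (simp add: m_assoc)
    moreover have "e \<otimes> (e \<ominus> g) = e \<ominus> g" using e g eg by (simp add: minus_eq r_distr r_minus)
    ultimately show "e \<ominus> g \<in> nilpotents R" by simp
  qed
  hence "e = g" using e g by simp
  hence "a = e \<otimes> a" using ag ae by simp
  also have "\<dots> = w \<otimes> a [^] (2::nat)"
    using \<open>e = g\<close> w a by (simp add: g_def m_assoc numeral_2_eq_2)
  finally show ?thesis using a w unfolding left_strongly_regular_def by blast
qed

end

definition opposite_ring :: "('a, 'b) ring_scheme \<Rightarrow> ('a, 'b) ring_scheme" where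
  "opposite_ring R = R\<lparr>mult := \<lambda>x y. y \<otimes>\<^bsub>R\<^esub> x\<rparr>"

lemma opposite_ring_simps [simp]:
  "carrier (opposite_ring R) = carrier R"
  "x \<otimes>\<^bsub>opposite_ring R\<^esub> y = y \<otimes>\<^bsub>R\<^esub> x"
  "x \<oplus>\<^bsub>opposite_ring R\<^esub> y = x \<oplus>\<^bsub>R\<^esub> y"
  "\<zero>\<^bsub>opposite_ring R\<^esub> = \<zero>\<^bsub>R\<^esub>"
  "\<one>\<^bsub>opposite_ring R\<^esub> = \<one>\<^bsub>R\<^esub>"
  by (simp_all add: opposite_ring_def)

context ring
begin

lemma ring_opposite: "ring (opposite_ring R)"
proof (rule ringI)
  show "abelian_group (opposite_ring R)"
  proof (rule abelian_groupI)
    fix x assume "x \<in> carrier (opposite_ring R)"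
    thus "\<exists>y\<in>carrier (opposite_ring R). y \<oplus>\<^bsub>opposite_ring R\<^esub> x = \<zero>\<^bsub>opposite_ring R\<^esub>"
      by (intro bexI[of _ "\<ominus> x"]) (auto simp: l_neg)
  qed (auto simp: a_assoc intro: a_comm)
  show "monoid (opposite_ring R)" by (rule monoidI) (auto simp: m_assoc)
qed (auto simp: l_distr r_distr)

lemma nat_pow_opposite:
  assumes "x \<in> carrier R"
  shows "x [^]\<^bsub>opposite_ring R\<^esub> (n::nat) = x [^] n"
proof (induction n)
  case 0
  show ?case by (simp add: nat_pow_def)
next
  case (Suc n)
  interpret opp: ring "opposite_ring R" by (rule ring_opposite)
  show ?case using Suc nat_pow_Suc2[OF assms] by simp
qed

lemma weakly_semicommutative_opposite:
  assumes "weakly_semicommutative R"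
  shows "weakly_semicommutative (opposite_ring R)"
proof -
  have "nilpotents (opposite_ring R) = nilpotents R"
    unfolding nilpotents_def by (auto simp: nat_pow_opposite)
  thus ?thesis
    using weakly_semicommutativeD[OF assms]
    unfolding weakly_semicommutative_def by (auto simp: m_assoc)
qed

lemma right_strongly_regular_opposite:
  "right_strongly_regular (opposite_ring R) a \<longleftrightarrow> left_strongly_regular R a"
  unfolding right_strongly_regular_def left_strongly_regular_def
  by (auto simp: nat_pow_opposite)

lemma left_strongly_regular_opposite:
  "left_strongly_regular (opposite_ring R) a \<longleftrightarrow> right_strongly_regular R a"
  unfolding right_strongly_regular_def left_strongly_regular_def
  by (auto simp: nat_pow_opposite)

lemma left_strongly_regular_imp_right:
  assumes "weakly_semicommutative R" "left_strongly_regular R a"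
  shows "right_strongly_regular R a"
  using ring.right_strongly_regular_imp_left[OF ring_opposite
      weakly_semicommutative_opposite[OF assms(1)]] assms(2)
  by (simp add: right_strongly_regular_opposite left_strongly_regular_opposite)

end

theorem corollary2p5:
  fixes R :: "('a, 'b) ring_scheme"
  assumes "ring R"
    and "weakly_semicommutative R"
  shows "Dischinger R"
  using ring.right_strongly_regular_imp_left[OF assms]
    ring.left_strongly_regular_imp_right[OF assms]
  unfolding Dischinger_def left_Dischinger_def right_Dischinger_def strongly_regular_def
  by blast

end
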